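(* Let $\mathcal{C}$ be an $[n,k,d]_q$ MDS code of distance $d\ge 4$, and let $\mathcal{V}^{(d-2)}$ be one of its cosets of weight $d-2$. Then, in terms of the value $B_{d-2}(\mathcal{V}^{(d-2)})$, the weight distribution of $\mathcal{V}^{(d-2)}$ is as follows: $$B_w(\mathcal{V}^{(d-2)})=0\ \text{ if } w=0,1,\ldots,d-3;$$ $$B_w(\mathcal{V}^{(d-2)})=A_w(\mathcal{C})-\Omega_w^{(0)}(n,d)+(-1)^{w-d}\binom{n-d+2}{n-w}B_{d-2}(\mathcal{V}^{(d-2)})\ \text{ if } w=d-1,d,\ldots,n.$$
   Context: An $[n,k,d]_q$ code is a $k$-dimensional $\mathbb{F}_q$-linear subspace of $\mathbb{F}_q^n$ with minimum Hamming distance $d$; it is MDS if $d=n-k+1$. A coset of $\mathcal{C}$ is a translate $\mathcal{C}+\mathbf{v}$, $\mathbf{v}\in\mathbb{F}_q^n$; the weight of a coset is the smallest Hamming weight of a vector in it. $A_w(\mathcal{C})$ is the number of codewords of Hamming weight $w$ in $\mathcal{C}$, and $B_w(\mathcal{V})$ is the number of vectors of Hamming weight $w$ in the coset $\mathcal{V}$. Notation: $\Omega_w^{(v)}(n,d)=(-1)^{w-d}\binom{n-v}{w-v}\binom{w-1-v}{d-2-v}$. *)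

theory Defs
  imports "HOL-Analysis.Cartesian_Space"
begin

text \<open>
  The finite field with \<open>q\<close> elements is a type \<open>'a :: {field, finite}\<close> with \<open>CARD('a) = q\<close>,
  and the space of words of length \<open>n\<close> over it is \<open>'a ^ 'n\<close> with \<open>CARD('n) = n\<close>.
\<close>

definition hamming_dist :: "'a ^ 'n \<Rightarrow> 'a ^ 'n \<Rightarrow> nat" where
  "hamming_dist x y = card {i. x $ i \<noteq> y $ i}"

definition hamming_weight :: "('a :: zero) ^ 'n \<Rightarrow> nat" where
  "hamming_weight x = card {i. x $ i \<noteq> 0}"

text \<open>
  A code with fewer than two words has no minimum distance; here it gets the
  value \<open>Inf {} = 0\<close>, which is not the distance of any other code.
\<close>

definition min_dist :: "('a ^ 'n) set \<Rightarrow> nat" where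
  "min_dist C = Inf {hamming_dist x y | x y. x \<in> C \<and> y \<in> C \<and> x \<noteq> y}"

definition linear_code ::
    "nat \<Rightarrow> nat \<Rightarrow> nat \<Rightarrow> nat \<Rightarrow> (('a :: {field, finite}) ^ 'n) set \<Rightarrow> bool" where
  "linear_code n k d q C \<longleftrightarrow>
     CARD('n) = n \<and> CARD('a) = q \<and> vec.subspace C \<and> vec.dim C = k \<and> min_dist C = d"

definition mds_code ::
    "nat \<Rightarrow> nat \<Rightarrow> nat \<Rightarrow> nat \<Rightarrow> (('a :: {field, finite}) ^ 'n) set \<Rightarrow> bool" where
  "mds_code n k d q C \<longleftrightarrow> linear_code n k d q C \<and> d = n - k + 1"

definition is_coset :: "(('a :: plus) ^ 'n) set \<Rightarrow> ('a ^ 'n) set \<Rightarrow> bool" where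
  "is_coset C V \<longleftrightarrow> (\<exists>v. V = {c + v | c. c \<in> C})"

definition coset_weight :: "(('a :: zero) ^ 'n) set \<Rightarrow> nat" where
  "coset_weight V = Inf (hamming_weight ` V)"

text \<open>This is \<open>A\<^sub>w\<close> when \<open>S\<close> is the code and \<open>B\<^sub>w\<close> when \<open>S\<close> is one of its cosets.\<close>

definition weight_count :: "(('a :: zero) ^ 'n) set \<Rightarrow> nat \<Rightarrow> nat" where
  "weight_count S w = card {x \<in> S. hamming_weight x = w}"

text \<open>
  The exponent \<open>w - d\<close> may be negative, hence the integer power in a field. The arguments of the
  binomial coefficients are subtractions on \<open>nat\<close>; they do not truncate in the intended range
  \<open>v + 2 \<le> d\<close>, \<open>d - 1 \<le> w \<le> n\<close>.
\<close>

definition Omega :: "nat \<Rightarrow> nat \<Rightarrow> nat \<Rightarrow> nat \<Rightarrow> real" where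
  "Omega v w n d =
     (-1) powi (int w - int d) * real ((n - v) choose (w - v)) * real ((w - 1 - v) choose (d - 2 - v))"

end

theory Submission
  imports Defs
begin

text \<open>
  A word of \<open>C\<close> is determined by any \<open>k\<close> of its coordinates, and these may be prescribed
  arbitrarily. Hence for every set \<open>J\<close> of at least \<open>d - 1 = n - k\<close> positions, \<open>V\<close> has as many words
  supported in \<open>J\<close> as \<open>C\<close>. Summing over all \<open>J\<close> of size \<open>s\<close> gives
  \<open>\<Sum>w\<le>s. (n - w choose s - w) (B\<^sub>w - A\<^sub>w) = 0\<close> for \<open>d - 1 \<le> s \<le> n\<close>, a triangular system
  that determines the differences \<open>B\<^sub>w - A\<^sub>w\<close> for \<open>w \<ge> d - 1\<close> from those for \<open>w \<le> d - 2\<close>; the latter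
  vanish except at \<open>w = 0\<close> and \<open>w = d - 2\<close>. It remains to check that the closed form solves the
  system.
\<close>

section \<open>Binomial sums\<close>

text \<open>Trinomial revision pulls out \<open>s choose m\<close> and leaves the alternating sum of
  row \<open>s - m\<close> of Pascal's triangle, which vanishes because the row index is
  positive.\<close>

lemma alternating_sum_choose_mult_choose:
  assumes "m < s"
  shows "(\<Sum>w=m..s. (-1) ^ (w + m) * (real (s choose w) * real (w choose m))) = 0"
proof -
  have "(\<Sum>w=m..s. (-1) ^ (w + m) * (real (s choose w) * real (w choose m)))
      = (\<Sum>i=0..s-m. (-1) ^ (i + m + m) * (real (s choose (i + m)) * real ((i + m) choose m)))"
    using sum.shift_bounds_cl_nat_ivl[of "\<lambda>w. (-1) ^ (w + m) * (real (s choose w) * real (w choose m))" 0 m "s - m"]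
      assms by simp
  also have "\<dots> = (\<Sum>i=0..s-m. real (s choose m) * ((-1) ^ i * real ((s - m) choose i)))"
  proof (rule sum.cong)
    fix i assume "i \<in> {0..s-m}"
    then have "(s choose (i + m)) * ((i + m) choose m) = (s choose m) * ((s - m) choose i)"
      using choose_mult[of m "i + m" s] assms by simp
    then have "real (s choose (i + m)) * real ((i + m) choose m) = real (s choose m) * real ((s - m) choose i)"
      by (metis of_nat_mult)
    moreover have "(-1::real) ^ (i + m + m) = (-1) ^ i"
      by (simp add: power_add flip: power_mult_distrib)
    ultimately show "(-1) ^ (i + m + m) * (real (s choose (i + m)) * real ((i + m) choose m))
        = real (s choose m) * ((-1) ^ i * real ((s - m) choose i))"
      by simp
  qed simp
  also have "\<dots> = 0"
    using choose_alternating_sum[of "s - m", where 'a = real] assms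
    by (simp add: atLeast0AtMost flip: sum_distrib_left)
  finally show ?thesis .
qed

text \<open>Induction on \<open>s\<close>: Pascal's rule splits \<open>Suc s choose w\<close> into a
  part covered by the induction hypothesis (\<open>?h\<close>) and a part (\<open>?g\<close>) that
  an index shift turns into the vanishing sum above.\<close>

lemma alternating_sum_choose_mult_choose_pred:
  assumes "m < s"
  shows "(\<Sum>w=Suc m..s. (-1) ^ (w + Suc m) * (real (s choose w) * real ((w - 1) choose m))) = 1"
proof -
  from assms have "Suc m \<le> s" by simp
  then show ?thesis
  proof (induction s rule: dec_induct)
    case base
    show ?case by (simp flip: power_mult_distrib add: power_add)
  next
    case (step s)
    let ?h = "\<lambda>w. (-1) ^ (w + Suc m) * (real (s choose w) * real ((w - 1) choose m))"
    let ?g = "\<lambda>w. (-1) ^ (w + Suc m) * (real (s choose (w - 1)) * real ((w - 1) choose m))"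
    have "(\<Sum>w=Suc m..Suc s. (-1) ^ (w + Suc m) * (real (Suc s choose w) * real ((w - 1) choose m)))
        = (\<Sum>w=Suc m..Suc s. ?h w + ?g w)"
    proof (rule sum.cong)
      fix w assume "w \<in> {Suc m..Suc s}"
      then obtain v where "w = Suc v" by (cases w) auto
      then show "(-1) ^ (w + Suc m) * (real (Suc s choose w) * real ((w - 1) choose m)) = ?h w + ?g w"
        by (simp add: algebra_simps)
    qed simp
    also have "\<dots> = sum ?h {Suc m..Suc s} + sum ?g {Suc m..Suc s}"
      by (rule sum.distrib)
    also have "sum ?h {Suc m..Suc s} = 1"
      using step by simp
    also have "sum ?g {Suc m..Suc s} = (\<Sum>w=m..s. (-1) ^ (w + m) * (real (s choose w) * real (w choose m)))"
      by (subst sum.shift_bounds_cl_Suc_ivl) simp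
    also have "\<dots> = 0"
      using step by (intro alternating_sum_choose_mult_choose) simp
    finally show ?case by simp
  qed
qed

text \<open>The coefficient of the unknown at \<open>w = s\<close> is 1, so the system is
  unitriangular and each equation fixes one new value.\<close>

lemma binomial_transform_cancel:
  fixes f g :: "nat \<Rightarrow> real"
  assumes low: "\<And>w. w < l \<Longrightarrow> f w = g w"
    and eq: "\<And>s. l \<le> s \<Longrightarrow> s \<le> n \<Longrightarrow>
      (\<Sum>w\<le>s. real ((n - w) choose (s - w)) * f w) = (\<Sum>w\<le>s. real ((n - w) choose (s - w)) * g w)"
    and "w \<le> n"
  shows "f w = g w"
  using \<open>w \<le> n\<close>
proof (induction w rule: less_induct)
  case (less s)
  show ?case
  proof (cases "s < l")
    case False
    have "(\<Sum>w<s. real ((n - w) choose (s - w)) * f w) = (\<Sum>w<s. real ((n - w) choose (s - w)) * g w)"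
      using less by (intro sum.cong) auto
    with eq[of s] False less.prems show ?thesis
      by (simp flip: lessThan_Suc_atMost)
  qed (rule low)
qed

text \<open>Here \<open>m\<close> stands for \<open>d - 2\<close> and \<open>b\<close> for the free
  parameter, the number of coset words of weight \<open>m\<close>. The multiple of \<open>b\<close>
  cancels by itself; the other part sums to \<open>n choose s\<close> and is compensated by the term
  at \<open>w = 0\<close>.\<close>

lemma binomial_transform_closed_form:
  fixes b :: real
  assumes "0 < m" "m < s" "s \<le> n"
  shows "(\<Sum>w\<le>s. real ((n - w) choose (s - w)) *
      (if w = 0 then - 1 else if w < m then 0
       else (-1) ^ (w + m) * (real ((n - m) choose (n - w)) * b - real (n choose w) * real ((w - 1) choose m)))) = 0"
    (is "(\<Sum>w\<le>s. ?c w * ?g w) = 0")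
proof -
  let ?p = "\<lambda>w. ?c w * ((-1) ^ (w + m) * real ((n - m) choose (n - w)))"
  let ?r = "\<lambda>w. ?c w * ((-1) ^ (w + m) * (real (n choose w) * real ((w - 1) choose m)))"
  have "(\<Sum>w\<le>s. ?c w * ?g w) = (\<Sum>w\<in>{0} \<union> {m..s}. ?c w * ?g w)"
    using assms by (intro sum.mono_neutral_right) auto
  also have "\<dots> = - real (n choose s) + (\<Sum>w=m..s. ?c w * ?g w)"
    using assms by (subst sum.union_disjoint) auto
  also have "(\<Sum>w=m..s. ?c w * ?g w) = (\<Sum>w=m..s. b * ?p w - ?r w)"
    using assms by (intro sum.cong) (auto simp: algebra_simps)
  also have "\<dots> = b * sum ?p {m..s} - sum ?r {m..s}"
    by (simp only: sum_subtractf sum_distrib_left)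
  \<comment> \<open>Substituting \<open>w = j + m\<close> reduces this to the alternating sum of row
    \<open>s - m\<close>.\<close>
  also have "sum ?p {m..s} = 0"
  proof -
    have "sum ?p {m..s} = (\<Sum>j=0..s-m. ?p (j + m))"
      using sum.shift_bounds_cl_nat_ivl[of ?p 0 m "s - m"] assms by simp
    also have "\<dots> = (\<Sum>j=0..s-m. real ((n - m) choose (s - m)) * ((-1) ^ j * real ((s - m) choose j)))"
    proof (rule sum.cong)
      fix j assume j: "j \<in> {0..s-m}"
      have "(n - m) choose (n - (j + m)) = (n - m) choose j"
        using j assms by (subst binomial_symmetric) auto
      moreover have "((n - m) choose (s - m)) * ((s - m) choose j)
          = ((n - m) choose j) * ((n - m - j) choose (s - m - j))"
        using j assms by (intro choose_mult) auto
      moreover have "n - m - j = n - (j + m)" "s - m - j = s - (j + m)" by auto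
      ultimately have "real ((n - (j + m)) choose (s - (j + m))) * real ((n - m) choose (n - (j + m)))
          = real ((n - m) choose (s - m)) * real ((s - m) choose j)"
        by (metis of_nat_mult mult.commute)
      moreover have "(-1::real) ^ (j + m + m) = (-1) ^ j"
        by (simp add: power_add flip: power_mult_distrib)
      ultimately show "?p (j + m) = real ((n - m) choose (s - m)) * ((-1) ^ j * real ((s - m) choose j))"
        by (simp only: mult.left_commute)
    qed simp
    also have "\<dots> = 0"
      using choose_alternating_sum[of "s - m", where 'a = real] assms
      by (simp add: atLeast0AtMost flip: sum_distrib_left)
    finally show ?thesis .
  qed
  \<comment> \<open>The term at \<open>w = m\<close> contains \<open>(m - 1) choose m\<close>, which
    is 0 since \<open>m > 0\<close>.\<close>
  also have "sum ?r {m..s} = sum ?r {Suc m..s}"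
    using assms by (subst sum.atLeast_Suc_atMost) auto
  also have "\<dots> = (\<Sum>w=Suc m..s. - real (n choose s) *
      ((-1) ^ (w + Suc m) * (real (s choose w) * real ((w - 1) choose m))))"
  proof (rule sum.cong)
    fix w assume "w \<in> {Suc m..s}"
    then have "(n choose s) * (s choose w) = (n choose w) * ((n - w) choose (s - w))"
      using assms by (intro choose_mult) auto
    then have *: "real (n choose w) * ?c w = real (n choose s) * real (s choose w)"
      by (metis of_nat_mult)
    have "?r w = (-1) ^ (w + m) * ((real (n choose w) * ?c w) * real ((w - 1) choose m))"
      by (simp only: ac_simps)
    then show "?r w = - real (n choose s) *
        ((-1) ^ (w + Suc m) * (real (s choose w) * real ((w - 1) choose m)))"
      unfolding * by simp
  qed simp
  also have "\<dots> = - real (n choose s)"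
    using alternating_sum_choose_mult_choose_pred[OF \<open>m < s\<close>]
    by (simp only: mult_1_right flip: sum_distrib_left)
  finally show ?thesis by simp
qed

section \<open>Words supported in a set of positions\<close>

lemma card_supersets_of_card:
  fixes A :: "'n::finite set"
  shows "card {J. A \<subseteq> J \<and> card J = s} =
    (if card A \<le> s then (CARD('n) - card A) choose (s - card A) else 0)"
proof (cases "card A \<le> s")
  case True
  have "card (A \<union> B) = s" if "B \<subseteq> - A" "card B = s - card A" for B
    using that True card_Un_disjoint[of A B] by auto
  then have "bij_betw (\<lambda>B. A \<union> B) {B. B \<subseteq> - A \<and> card B = s - card A} {J. A \<subseteq> J \<and> card J = s}"
    by (intro bij_betw_byWitness[where f' = "\<lambda>J. J - A"]) (auto simp: card_Diff_subset)
  then have "card {J. A \<subseteq> J \<and> card J = s} = card {B. B \<subseteq> - A \<and> card B = s - card A}"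
    by (simp add: bij_betw_same_card)
  then show ?thesis
    using True n_subsets[of "- A" "s - card A"] by (simp add: card_Diff_subset Compl_eq_Diff_UNIV)
next
  case False
  then have "{J. A \<subseteq> J \<and> card J = s} = {}"
    using card_mono[of _ A] by fastforce
  with False show ?thesis by simp
qed

text \<open>Double counting of pairs (word, set): the sets of size \<open>s\<close> around the
  support of a word of weight \<open>w\<close> leave \<open>s - w\<close> positions to be chosen
  among the other \<open>CARD('n) - w\<close>.\<close>

lemma sum_card_supported_words:
  fixes S :: "('a :: {zero, finite} ^ 'n) set"
  shows "(\<Sum>J | card J = s. card {x \<in> S. {i. x $ i \<noteq> 0} \<subseteq> J}) =
    (\<Sum>w\<le>s. ((CARD('n) - w) choose (s - w)) * weight_count S w)"
proof -
  let ?c = "\<lambda>w. (CARD('n) - w) choose (s - w)"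
  have "(\<Sum>J | card J = s. card {x \<in> S. {i. x $ i \<noteq> 0} \<subseteq> J}) =
      (\<Sum>J\<in>{J. card J = s}. \<Sum>x\<in>{x \<in> S. {i. x $ i \<noteq> 0} \<subseteq> J}. 1)"
    by simp
  also have "\<dots> = (\<Sum>x\<in>S. \<Sum>J\<in>{J \<in> {J. card J = s}. {i. x $ i \<noteq> 0} \<subseteq> J}. 1)"
    by (rule sum.swap_restrict) auto
  also have "\<dots> = (\<Sum>x\<in>S. card {J. {i. x $ i \<noteq> 0} \<subseteq> J \<and> card J = s})"
    by (simp add: conj_commute)
  also have "\<dots> = (\<Sum>x\<in>S. if hamming_weight x \<le> s then ?c (hamming_weight x) else 0)"
    unfolding card_supersets_of_card hamming_weight_def by (rule refl)
  also have "\<dots> = (\<Sum>x\<in>{x \<in> S. hamming_weight x \<le> s}. ?c (hamming_weight x))"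
    by (simp add: sum.inter_filter)
  also have "\<dots> = (\<Sum>w\<le>s. \<Sum>x\<in>{x \<in> {x \<in> S. hamming_weight x \<le> s}. hamming_weight x = w}. ?c (hamming_weight x))"
    by (rule sum.group[symmetric]) auto
  also have "\<dots> = (\<Sum>w\<le>s. ?c w * weight_count S w)"
  proof (rule sum.cong)
    fix w assume "w \<in> {..s}"
    then have "{x \<in> {x \<in> S. hamming_weight x \<le> s}. hamming_weight x = w} = {x \<in> S. hamming_weight x = w}"
      by auto
    then show "(\<Sum>x\<in>{x \<in> {x \<in> S. hamming_weight x \<le> s}. hamming_weight x = w}. ?c (hamming_weight x))
        = ?c w * weight_count S w"
      by (simp add: weight_count_def)
  qed simp
  finally show ?thesis .
qed

lemma hamming_weight_eq_0_iff: "hamming_weight x = 0 \<longleftrightarrow> x = 0"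
  by (auto simp: hamming_weight_def vec_eq_iff)

section \<open>Cosets of MDS codes\<close>

lemma min_dist_le_hamming_weight:
  fixes C :: "(('a :: field) ^ 'n) set"
  assumes "vec.subspace C" "c \<in> C" "c \<noteq> 0"
  shows "min_dist C \<le> hamming_weight c"
proof -
  have "hamming_weight c = hamming_dist c 0"
    by (simp add: hamming_weight_def hamming_dist_def)
  moreover have "0 \<in> C"
    using assms by (simp add: vec.subspace_0)
  ultimately show ?thesis
    unfolding min_dist_def using assms by (intro wellorder_Inf_le1) blast
qed

text \<open>Zeroing the coordinates outside \<open>K\<close>, instead of dropping them, makes the
  projection an endomorphism of a single type.\<close>

lemma linear_restrict_coordinates:
  "Vector_Spaces.linear (*s) (*s) (\<lambda>x :: 'a::field ^ 'n. \<chi> i. if i \<in> K then x $ i else 0)"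
  by (auto simp: Vector_Spaces.linear_iff vec.vector_space_axioms vec_eq_iff)

text \<open>Enlarge \<open>K\<close> to a set \<open>L\<close> of size \<open>k\<close>. Two
  codewords that agree on \<open>L\<close> differ in at most \<open>n - k < d\<close> places, so
  projection to \<open>L\<close> is injective on \<open>C\<close>; comparing dimensions makes it
  onto.\<close>

lemma mds_code_interpolation:
  fixes C :: "(('a :: {field, finite}) ^ 'n) set"
  assumes "mds_code n k d q C" "card K \<le> k"
  obtains c where "c \<in> C" "\<And>i. i \<in> K \<Longrightarrow> c $ i = y $ i"
proof -
  from assms have C: "vec.subspace C" "vec.dim C = k" and n: "CARD('n) = n"
    and d: "min_dist C = n - k + 1"
    by (auto simp: mds_code_def linear_code_def)
  have "k \<le> n"
    using vec.dim_subset[OF subset_UNIV, of C] unfolding vec_dim_card C n .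
  then obtain L where L: "K \<subseteq> L" "card L = k"
    using assms(2) n exists_subset_between[of K k UNIV] by auto
  let ?f = "\<lambda>x :: 'a ^ 'n. \<chi> i. if i \<in> L then x $ i else 0"
  have "inj_on ?f C"
  proof (rule inj_onI, rule ccontr)
    fix x y assume xy: "x \<in> C" "y \<in> C" "?f x = ?f y" "x \<noteq> y"
    then have "x - y \<in> C" "x - y \<noteq> 0"
      using C by (auto simp: vec.subspace_diff)
    then have "n - k + 1 \<le> hamming_weight (x - y)"
      using min_dist_le_hamming_weight C d by metis
    also have "\<dots> \<le> card (- L)"
      unfolding hamming_weight_def
    proof (rule card_mono)
      show "{i. (x - y) $ i \<noteq> 0} \<subseteq> - L"
        using xy(3) by (auto simp: vec_eq_iff) metis
    qed simp
    also have "\<dots> = n - k"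
      using L n by (simp add: card_Diff_subset Compl_eq_Diff_UNIV)
    finally show False by simp
  qed
  then have dim: "vec.dim (?f ` C) = k"
    using vec.dim_image_eq[OF linear_restrict_coordinates[of L], of C] C
    by (simp only: vec.span_eq_iff[THEN iffD2])
  let ?T = "{x :: 'a ^ 'n. \<forall>i. i \<notin> L \<longrightarrow> x $ i = 0}"
  \<comment> \<open>\<open>?T\<close> has dimension \<open>card L = k\<close>, like the image it
    contains.\<close>
  have "?f ` C = ?T"
  proof (rule vec.subspace_dim_equal)
    show "vec.subspace (?f ` C)"
      by (rule vec.linear_subspace_image[OF linear_restrict_coordinates C(1)])
    show "vec.subspace ?T"
      by (auto simp: vec.subspace_def)
    show "vec.dim ?T \<le> vec.dim (?f ` C)"
      using L by (simp add: dim dim_substandard_cart)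
  qed auto
  moreover have "?f y \<in> ?T" by simp
  ultimately obtain c where c: "c \<in> C" "?f y = ?f c" by blast
  show thesis
  proof
    show "c $ i = y $ i" if "i \<in> K" for i
      using c(2) L that by (auto simp: vec_eq_iff) (metis subsetD)
  qed fact
qed

text \<open>Interpolating \<open>- v\<close> on the complement of \<open>J\<close> yields a coset
  representative supported in \<open>J\<close>; translation by it preserves being supported in
  \<open>J\<close> and maps \<open>C\<close> onto \<open>V\<close>.\<close>

lemma card_supported_words_coset_mds_code:
  fixes C V :: "(('a :: {field, finite}) ^ 'n) set"
  assumes "mds_code n k d q C" "is_coset C V" "d - 1 \<le> card J"
  shows "card {x \<in> V. {i. x $ i \<noteq> 0} \<subseteq> J} = card {x \<in> C. {i. x $ i \<noteq> 0} \<subseteq> J}"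
proof -
  from assms have C: "vec.subspace C" "vec.dim C = k" and n: "CARD('n) = n" and d: "d = n - k + 1"
    by (auto simp: mds_code_def linear_code_def)
  from assms obtain v where V: "V = {c + v | c. c \<in> C}"
    by (auto simp: is_coset_def)
  \<comment> \<open>This is where the MDS condition \<open>d - 1 = n - k\<close> enters.\<close>
  have "card (- J) \<le> k"
    using assms d n by (simp add: card_Diff_subset Compl_eq_Diff_UNIV)
  then obtain c where c: "c \<in> C" "\<And>i. i \<in> - J \<Longrightarrow> c $ i = (- v) $ i"
    using mds_code_interpolation[OF assms(1)] by blast
  let ?u = "c + v"
  have u: "?u $ i = 0" if "i \<notin> J" for i
    using c(2)[of i] that by simp
  have V_iff: "x \<in> V \<longleftrightarrow> x - ?u \<in> C" for x
  proof
    assume "x \<in> V"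
    then obtain c' where "c' \<in> C" "x = c' + v" by (auto simp: V)
    then show "x - ?u \<in> C" using c C by (simp add: vec.subspace_diff)
  next
    assume "x - ?u \<in> C"
    then have "x - ?u + c \<in> C" by (rule vec.subspace_add[OF C(1) _ c(1)])
    moreover have "x = (x - ?u + c) + v" by simp
    ultimately show "x \<in> V" unfolding V by blast
  qed
  have "bij_betw (\<lambda>x. x + ?u) {x \<in> C. {i. x $ i \<noteq> 0} \<subseteq> J} {x \<in> V. {i. x $ i \<noteq> 0} \<subseteq> J}"
  proof (rule bij_betw_byWitness[where f' = "\<lambda>x. x - ?u"])
    show "(\<lambda>x. x + ?u) ` {x \<in> C. {i. x $ i \<noteq> 0} \<subseteq> J} \<subseteq> {x \<in> V. {i. x $ i \<noteq> 0} \<subseteq> J}"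
      using u by (force simp: V_iff)
    show "(\<lambda>x. x - ?u) ` {x \<in> V. {i. x $ i \<noteq> 0} \<subseteq> J} \<subseteq> {x \<in> C. {i. x $ i \<noteq> 0} \<subseteq> J}"
      using u by (force simp: V_iff)
  qed auto
  then show ?thesis by (simp add: bij_betw_same_card)
qed

lemma weight_count_less_coset_weight:
  assumes "w < coset_weight V"
  shows "weight_count V w = 0"
proof -
  have "coset_weight V \<le> hamming_weight x" if "x \<in> V" for x
    unfolding coset_weight_def using that by (intro wellorder_Inf_le1) blast
  with assms have "{x \<in> V. hamming_weight x = w} = {}" by force
  then show ?thesis unfolding weight_count_def by (metis card.empty)
qed

lemma weight_count_less_min_dist:
  fixes C :: "(('a :: field) ^ 'n) set"
  assumes "vec.subspace C" "w < min_dist C"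
  shows "weight_count C w = (if w = 0 then 1 else 0)"
proof (cases "w = 0")
  case True
  then have "{x \<in> C. hamming_weight x = w} = {0}"
    using assms by (auto simp: hamming_weight_eq_0_iff vec.subspace_0)
  with True show ?thesis by (simp add: weight_count_def)
next
  case False
  have "x \<notin> C" if "hamming_weight x = w" for x
    using False assms min_dist_le_hamming_weight[of C x] hamming_weight_eq_0_iff[of x] that by auto
  then have "{x \<in> C. hamming_weight x = w} = {}" by blast
  with False show ?thesis unfolding weight_count_def by (metis card.empty)
qed

text \<open>Only parity matters, so the possibly negative exponent can be traded for a natural
  number.\<close>

lemma minus_one_powi_diff: "(-1 :: real) powi (int a - int b) = (-1) ^ (a + b)"
  by (cases "even b") (simp_all add: power_int_diff power_add)

theorem theorem4p5:
  fixes C V :: "(('a :: {field, finite}) ^ 'n) set"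
    and n k d q :: nat
  assumes "mds_code n k d q C"
    and "d \<ge> 4"
    and "is_coset C V"
    and "coset_weight V = d - 2"
  shows "(\<forall>w\<in>{0..d - 3}. weight_count V w = 0) \<and>
         (\<forall>w\<in>{d - 1..n}. real (weight_count V w) =
            real (weight_count C w) - Omega 0 w n d
            + (-1) powi (int w - int d) * real ((n - d + 2) choose (n - w))
              * real (weight_count V (d - 2)))"
proof (intro conjI ballI)
  fix w assume "w \<in> {0..d - 3}"
  then show "weight_count V w = 0"
    using assms by (intro weight_count_less_coset_weight) auto
next
  fix w assume w: "w \<in> {d - 1..n}"
  from assms have C: "vec.subspace C" "min_dist C = d" and n: "CARD('n) = n" and d: "d = n - k + 1"
    by (auto simp: mds_code_def linear_code_def)
  define m where "m = d - 2"
  have m: "0 < m" "d = m + 2" "coset_weight V = m"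
    using assms by (auto simp: m_def)
  let ?f = "\<lambda>w. real (weight_count V w) - real (weight_count C w)"
  \<comment> \<open>The claimed difference of the two weight counts, extended below
    \<open>m\<close>: at \<open>w = 0\<close> only \<open>C\<close> contributes, by its zero word,
    as \<open>V\<close> has positive weight.\<close>
  let ?g = "\<lambda>w. if w = 0 then - 1 else if w < m then 0
    else (-1) ^ (w + m) * (real ((n - m) choose (n - w)) * real (weight_count V m)
      - real (n choose w) * real ((w - 1) choose m))"
  have "?f w = ?g w"
  \<comment> \<open>The equations start at \<open>s = Suc m = d - 1\<close>, so agreement must be
    checked directly up to and including \<open>w = m\<close>.\<close>
  proof (rule binomial_transform_cancel[where l = "Suc m" and n = n and f = ?f and g = ?g])
    fix v assume "v < Suc m"
    moreover from this have "weight_count C v = (if v = 0 then 1 else 0)"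
      using C m by (intro weight_count_less_min_dist) auto
    moreover have "v < m \<Longrightarrow> weight_count V v = 0"
      using m by (intro weight_count_less_coset_weight) auto
    \<comment> \<open>At \<open>v = m\<close> the sign is positive,
      \<open>(m - 1) choose m = 0\<close>, and \<open>C\<close> has no words of weight
      \<open>m < d\<close>; both sides become \<open>weight_count V m\<close>.\<close>
    moreover have "(-1::real) ^ (m + m) = 1"
      by simp
    ultimately show "?f v = ?g v"
      using m by (cases "v = m") auto
  next
    fix s assume s: "Suc m \<le> s" "s \<le> n"
    have "(\<Sum>J | card J = s. card {x \<in> V. {i. x $ i \<noteq> 0} \<subseteq> J})
        = (\<Sum>J | card J = s. card {x \<in> C. {i. x $ i \<noteq> 0} \<subseteq> J})"
      using assms(1,3) s m by (intro sum.cong refl card_supported_words_coset_mds_code) auto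
    then have "(\<Sum>w\<le>s. ((n - w) choose (s - w)) * weight_count V w)
        = (\<Sum>w\<le>s. ((n - w) choose (s - w)) * weight_count C w)"
      by (simp only: sum_card_supported_words n)
    then have "(\<Sum>w\<le>s. real ((n - w) choose (s - w)) * real (weight_count V w))
        = (\<Sum>w\<le>s. real ((n - w) choose (s - w)) * real (weight_count C w))"
      by (simp only: flip: of_nat_mult of_nat_sum)
    then have "(\<Sum>w\<le>s. real ((n - w) choose (s - w)) * ?f w) = 0"
      by (simp only: right_diff_distrib sum_subtractf diff_self)
    moreover have "(\<Sum>w\<le>s. real ((n - w) choose (s - w)) * ?g w) = 0"
      using s m by (intro binomial_transform_closed_form) auto
    ultimately show "(\<Sum>w\<le>s. real ((n - w) choose (s - w)) * ?f w)
        = (\<Sum>w\<le>s. real ((n - w) choose (s - w)) * ?g w)"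
      by (simp only:)
  qed (use w in auto)
  then have *: "real (weight_count V w) = real (weight_count C w)
      + (-1) ^ (w + m) * (real ((n - m) choose (n - w)) * real (weight_count V m)
        - real (n choose w) * real ((w - 1) choose m))"
    using w m by (simp split: if_splits)
  \<comment> \<open>If \<open>d = n + 1\<close> then \<open>n - d\<close> truncates, but then \<open>w = n\<close> and the binomial coefficient is 1.\<close>
  have choose: "(n - d + 2) choose (n - w) = (n - m) choose (n - w)"
  proof (cases "d \<le> n")
    case True
    then have "n - d + 2 = n - m" using m by simp
    then show ?thesis by simp
  next
    case False
    then have "w = n" using w d by simp
    then show ?thesis by simp
  qed
  \<comment> \<open>\<open>d = m + 2\<close> has the parity of \<open>m\<close>.\<close>
  have sign: "(-1 :: real) powi (int w - int d) = (-1) ^ (w + m)"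
    using minus_one_powi_diff[of w d] m by simp
  show "real (weight_count V w) = real (weight_count C w) - Omega 0 w n d
      + (-1) powi (int w - int d) * real ((n - d + 2) choose (n - w)) * real (weight_count V (d - 2))"
    unfolding Omega_def sign choose * m_def[symmetric] by (simp add: algebra_simps)
qed

end
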